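(* The functions $\|\cdot\|_1, \|\cdot\|_\infty : \mathbb{DQ}^n \to \mathbb{D}$ defined for $\mathbf{x} = (x_1,\dots,x_n)^\top \in \mathbb{DQ}^n$ by $$\|\mathbf{x}\|_1 = \sum_{i=1}^n |x_i|, \qquad \|\mathbf{x}\|_\infty = \max_{i=1,\dots,n} |x_i|$$ are norms on $\mathbb{DQ}^n$; that is, each $v \in \{\|\cdot\|_1, \|\cdot\|_\infty\}$ satisfies: 1. for any $\mathbf{x} \in \mathbb{DQ}^n$, $v(\mathbf{x}) \ge 0$, and $v(\mathbf{x}) = 0$ if and only if $\mathbf{x} = \mathbf{0}$; 2. for any $\mathbf{x} \in \mathbb{DQ}^n$ and $q \in \mathbb{DQ}$, $v(q\mathbf{x}) = |q|\,v(\mathbf{x})$; 3. for any $\mathbf{x}, \mathbf{y} \in \mathbb{DQ}^n$, $v(\mathbf{x}+\mathbf{y}) \le v(\mathbf{x}) + v(\mathbf{y})$.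
   Context: Dual numbers: $\mathbb{D}$ is the set of $a = a_{st} + a_{\mathcal{I}}\epsilon$ with $a_{st}, a_{\mathcal{I}} \in \mathbb{R}$ and $\epsilon^2 = 0$, with componentwise addition and product $ab = a_{st}b_{st} + (a_{st}b_{\mathcal{I}} + a_{\mathcal{I}}b_{st})\epsilon$. Total order on $\mathbb{D}$: $a < b$ if $a_{st} < b_{st}$, or $a_{st} = b_{st}$ and $a_{\mathcal{I}} < b_{\mathcal{I}}$; $a \le b$ means $a<b$ or $a=b$. The maximum is taken with respect to this order. Quaternions: $\mathbb{Q}$ denotes the set of real (Hamilton) quaternions $q = q_0 + q_1\mathbf{i} + q_2\mathbf{j} + q_3\mathbf{k}$, with conjugate $q^* = q_0 - q_1\mathbf{i} - q_2\mathbf{j} - q_3\mathbf{k}$ and magnitude $|q| = \sqrt{q_0^2+q_1^2+q_2^2+q_3^2}$. Dual quaternions: $\mathbb{DQ}$ is the set of $q = q_{st} + q_{\mathcal{I}}\epsilon$ with $q_{st}, q_{\mathcal{I}} \in \mathbb{Q}$, where $\epsilon^2=0$ and $\epsilon$ commutes with quaternions; so $pq = p_{st}q_{st} + (p_{st}q_{\mathcal{I}} + p_{\mathcal{I}}q_{st})\epsilon$. The magnitude of $q \in \mathbb{DQ}$ is the dual number $$|q| = |q_{st}| + \frac{q_{st}q_{\mathcal{I}}^* + q_{\mathcal{I}}q_{st}^*}{2|q_{st}|}\epsilon \ \text{ if } q_{st} \neq 0, \qquad |q| = |q_{\mathcal{I}}|\epsilon \ \text{ if } q_{st} = 0$$ (the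 quaternion $q_{st}q_{\mathcal{I}}^* + q_{\mathcal{I}}q_{st}^*$ is real). $\mathbb{DQ}^n$ is the set of $n$-dimensional dual quaternion vectors, with componentwise addition and $q\mathbf{x} = (qx_1,\dots,qx_n)^\top$. *)

theory Defs
  imports "HOL-Analysis.Analysis"
begin

section \<open>Quaternions\<close>

datatype quat = Quat (qre: real) (qim1: real) (qim2: real) (qim3: real)

lemma quat_eq_iff:
  "p = q \<longleftrightarrow> qre p = qre q \<and> qim1 p = qim1 q \<and> qim2 p = qim2 q \<and> qim3 p = qim3 q"
  by (cases p; cases q) simp

instantiation quat :: ring_1
begin

definition zero_quat :: quat where "0 = Quat 0 0 0 0"

definition one_quat :: quat where "1 = Quat 1 0 0 0"

definition plus_quat :: "quat \<Rightarrow> quat \<Rightarrow> quat" where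
  "p + q = Quat (qre p + qre q) (qim1 p + qim1 q) (qim2 p + qim2 q) (qim3 p + qim3 q)"

definition uminus_quat :: "quat \<Rightarrow> quat" where
  "- q = Quat (- qre q) (- qim1 q) (- qim2 q) (- qim3 q)"

definition minus_quat :: "quat \<Rightarrow> quat \<Rightarrow> quat" where
  "p - q = Quat (qre p - qre q) (qim1 p - qim1 q) (qim2 p - qim2 q) (qim3 p - qim3 q)"

definition times_quat :: "quat \<Rightarrow> quat \<Rightarrow> quat" where
  "p * q = Quat
     (qre p * qre q - qim1 p * qim1 q - qim2 p * qim2 q - qim3 p * qim3 q)
     (qre p * qim1 q + qim1 p * qre q + qim2 p * qim3 q - qim3 p * qim2 q)
     (qre p * qim2 q - qim1 p * qim3 q + qim2 p * qre q + qim3 p * qim1 q)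
     (qre p * qim3 q + qim1 p * qim2 q - qim2 p * qim1 q + qim3 p * qre q)"

instance
  by standard
    (simp_all add: quat_eq_iff zero_quat_def one_quat_def plus_quat_def uminus_quat_def
      minus_quat_def times_quat_def algebra_simps)

end

lemma quat_units:
  defines "i \<equiv> Quat 0 1 0 0" and "j \<equiv> Quat 0 0 1 0" and "k \<equiv> Quat 0 0 0 1"
  shows "i * i = - 1" "j * j = - 1" "k * k = - 1" "i * j = k" "j * k = i" "k * i = j"
    "j * i = - k" "k * j = - i" "i * k = - j"
  by (simp_all add: i_def j_def k_def times_quat_def uminus_quat_def one_quat_def)

definition qcnj :: "quat \<Rightarrow> quat" where
  "qcnj q = Quat (qre q) (- qim1 q) (- qim2 q) (- qim3 q)"

definition qmod :: "quat \<Rightarrow> real" where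
  "qmod q = sqrt ((qre q)\<^sup>2 + (qim1 q)\<^sup>2 + (qim2 q)\<^sup>2 + (qim3 q)\<^sup>2)"

section \<open>Dual numbers over a ring\<close>

text \<open>\<open>Dual a b\<close> stands for \<open>a + b \<epsilon>\<close> with \<open>\<epsilon>\<^sup>2 = 0\<close> and \<open>\<epsilon>\<close> central. Taking \<open>'a = real\<close>
  gives the dual numbers, \<open>'a = quat\<close> the dual quaternions.\<close>

datatype 'a dual = Dual (st: 'a) (infi: 'a)

type_synonym dual_number = "real dual"
type_synonym dual_quaternion = "quat dual"

lemma dual_eq_iff: "a = b \<longleftrightarrow> st a = st b \<and> infi a = infi b"
  by (cases a; cases b) simp

instantiation dual :: (ring_1) ring_1
begin

definition zero_dual :: "'a dual" where "0 = Dual 0 0"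

definition one_dual :: "'a dual" where "1 = Dual 1 0"

definition plus_dual :: "'a dual \<Rightarrow> 'a dual \<Rightarrow> 'a dual" where
  "a + b = Dual (st a + st b) (infi a + infi b)"

definition uminus_dual :: "'a dual \<Rightarrow> 'a dual" where
  "- a = Dual (- st a) (- infi a)"

definition minus_dual :: "'a dual \<Rightarrow> 'a dual \<Rightarrow> 'a dual" where
  "a - b = Dual (st a - st b) (infi a - infi b)"

definition times_dual :: "'a dual \<Rightarrow> 'a dual \<Rightarrow> 'a dual" where
  "a * b = Dual (st a * st b) (st a * infi b + infi a * st b)"

instance
  by standard
    (simp_all add: dual_eq_iff zero_dual_def one_dual_def plus_dual_def uminus_dual_def
      minus_dual_def times_dual_def algebra_simps)

end

instantiation dual :: (linorder) linorder
begin

definition less_dual :: "'a dual \<Rightarrow> 'a dual \<Rightarrow> bool" where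
  "a < b \<longleftrightarrow> st a < st b \<or> st a = st b \<and> infi a < infi b"

definition less_eq_dual :: "'a dual \<Rightarrow> 'a dual \<Rightarrow> bool" where
  "a \<le> b \<longleftrightarrow> a < b \<or> a = (b :: 'a dual)"

instance
  by standard (auto simp: less_dual_def less_eq_dual_def dual_eq_iff)

end

section \<open>Magnitude and norms\<close>

text \<open>The next lemma justifies reading off the real part in the definition of the magnitude.\<close>

lemma st_infi_cnj_real:
  "p * qcnj q + q * qcnj p = Quat (qre (p * qcnj q + q * qcnj p)) 0 0 0"
  by (simp add: quat_eq_iff times_quat_def plus_quat_def qcnj_def)

definition dq_mag :: "dual_quaternion \<Rightarrow> dual_number" where
  "dq_mag q =
     (if st q \<noteq> 0
      then Dual (qmod (st q))
             (qre (st q * qcnj (infi q) + infi q * qcnj (st q)) / (2 * qmod (st q)))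
      else Dual 0 (qmod (infi q)))"

definition dq_norm_1 :: "dual_quaternion ^ 'n \<Rightarrow> dual_number" where
  "dq_norm_1 x = (\<Sum>i\<in>UNIV. dq_mag (x $ i))"

definition dq_norm_inf :: "dual_quaternion ^ 'n \<Rightarrow> dual_number" where
  "dq_norm_inf x = Max (range (\<lambda>i. dq_mag (x $ i)))"

definition is_dq_norm :: "(dual_quaternion ^ 'n \<Rightarrow> dual_number) \<Rightarrow> bool" where
  "is_dq_norm v \<longleftrightarrow>
     (\<forall>x. v x \<ge> 0 \<and> (v x = 0 \<longleftrightarrow> x = 0)) \<and>
     (\<forall>x q. v (q *s x) = dq_mag q * v x) \<and>
     (\<forall>x y. v (x + y) \<le> v x + v y)"

end

theory Submission
  imports Defs
begin

text \<open>
  Both claims reduce to three properties of the magnitude on \<open>\<D>\<Q>\<close>: it is positive definite,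
  multiplicative, and subadditive. The passage to vectors then only uses that the lexicographic
  order turns the dual numbers into an ordered ring: sums of inequalities may be formed, and
  multiplication by a nonnegative dual number is monotone, so that it commutes with \<open>Max\<close>.
  (Strict monotonicity fails, since \<open>\<epsilon>\<close> is a positive zero divisor.)

  The quaternions are identified with the Euclidean space \<open>\<real>\<^sup>4\<close>. For \<open>u \<noteq> 0\<close> the infinitesimal part
  of \<open>|u + v \<epsilon>|\<close> is the inner product \<open>sgn u \<bullet> v\<close>, that is, the derivative of the norm at \<open>u\<close> in the
  direction \<open>v\<close>. Subadditivity is then a first-order refinement of the triangle
  inequality, valid in every real inner product space: if the inequality for the standard parts is
  strict, the infinitesimal parts do not matter; if it is an equality between nonzero vectors, they
  point in the same direction, and the infinitesimal part is linear along that direction; if exactly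
  one standard part vanishes, what remains is the Cauchy-Schwarz inequality, and if both do, it is
  the triangle inequality for the infinitesimal parts.
  Multiplicativity comes from the fact that left and right multiplication by a quaternion \<open>p\<close>
  scale the inner product by \<open>|p|\<^sup>2\<close>.
\<close>

section \<open>The ordered ring of dual numbers\<close>

lemma dual_nonneg_iff: "0 \<le> a \<longleftrightarrow> 0 < st a \<or> st a = 0 \<and> 0 \<le> infi a"
  for a :: "'a::linordered_idom dual"
  by (auto simp: less_eq_dual_def less_dual_def zero_dual_def dual_eq_iff)

text \<open>For a product of nonnegative \<open>a\<close> and \<open>c\<close> the infinitesimal part can only be negative
  when both standard parts are positive, and then the standard part of the product decides.\<close>

lemma dual_mult_nonneg:
  fixes a c :: "'a::linordered_idom dual"
  assumes "0 \<le> a" "0 \<le> c"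
  shows "0 \<le> a * c"
  using assms by (auto simp: dual_nonneg_iff times_dual_def)

instance dual :: (linordered_idom) ordered_ring
proof
  fix a b c :: "'a dual"
  show "c + a \<le> c + b" if "a \<le> b"
    using that by (auto simp: less_eq_dual_def less_dual_def plus_dual_def dual_eq_iff)
  have diff: "x \<le> y \<longleftrightarrow> 0 \<le> y - x" for x y :: "'a dual"
    by (auto simp: less_eq_dual_def less_dual_def minus_dual_def zero_dual_def dual_eq_iff)
  show "c * a \<le> c * b" if "a \<le> b" "0 \<le> c"
    using dual_mult_nonneg[of c "b - a"] that diff[of a b] diff[of "c * a" "c * b"]
    by (simp add: right_diff_distrib)
  show "a * c \<le> b * c" if "a \<le> b" "0 \<le> c"
    using dual_mult_nonneg[of "b - a" c] that diff[of a b] diff[of "a * c" "b * c"]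
    by (simp add: left_diff_distrib)
qed

section \<open>The dual norm of an inner product space\<close>

text \<open>This is the value at \<open>u + v \<epsilon>\<close> of the norm extended to dual vectors by its first-order Taylor
  expansion; at \<open>u = 0\<close>, where the norm is not differentiable, homogeneity dictates \<open>norm v\<close>.\<close>

definition dual_norm :: "'a::real_inner \<Rightarrow> 'a \<Rightarrow> dual_number" where
  "dual_norm u v = (if u \<noteq> 0 then Dual (norm u) (sgn u \<bullet> v) else Dual 0 (norm v))"

lemma dual_norm_nonneg: "0 \<le> dual_norm u v"
  by (auto simp: dual_norm_def less_eq_dual_def less_dual_def zero_dual_def dual_eq_iff)

lemma dual_norm_eq_0_iff: "dual_norm u v = 0 \<longleftrightarrow> u = 0 \<and> v = 0"
  by (auto simp: dual_norm_def zero_dual_def)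

lemma inner_sgn_eq: "sgn u \<bullet> v = u \<bullet> v / norm u" for u v :: "'a::real_inner"
  by (simp only: sgn_div_norm inner_scaleR_left divide_inverse mult.commute)

lemma inner_sgn_le_norm: "sgn u \<bullet> v \<le> norm v" for u v :: "'a::real_inner"
proof -
  have "sgn u \<bullet> v \<le> norm (sgn u) * norm v"
    by (rule norm_cauchy_schwarz)
  also have "\<dots> \<le> norm v"
    by (simp add: norm_sgn)
  finally show ?thesis .
qed

text \<open>Equality in the triangle inequality forces \<open>w\<close> to be a positive multiple of \<open>u\<close>.\<close>

lemma sgn_add_of_norm_add_eq:
  fixes u w :: "'a::real_inner"
  assumes "u \<noteq> 0" "w \<noteq> 0" "norm (u + w) = norm u + norm w"
  shows "sgn w = sgn u" "sgn (u + w) = sgn u"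
proof -
  have dir: "norm u *\<^sub>R w = norm w *\<^sub>R u"
    using assms(3) by (simp add: norm_triangle_eq)
  define k where "k = norm w / norm u"
  have k: "0 < k"
    using assms by (simp add: k_def)
  have "w = (1 / norm u) *\<^sub>R (norm u *\<^sub>R w)"
    using assms(1) by simp
  also have "\<dots> = k *\<^sub>R u"
    by (simp add: dir k_def)
  finally have w: "w = k *\<^sub>R u" .
  show "sgn w = sgn u"
    using k by (simp only: w sgn_scaleR sgn_pos scaleR_one)
  have "u + w = (1 + k) *\<^sub>R u"
    by (simp add: w scaleR_left_distrib)
  moreover have "0 < 1 + k"
    using k by simp
  ultimately show "sgn (u + w) = sgn u"
    by (simp only: sgn_scaleR sgn_pos scaleR_one)
qed

text \<open>Infinitesimal parts need comparing only where the standard parts tie. For nonzero \<open>u\<close> and \<open>w\<close>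
  that means that \<open>u\<close>, \<open>w\<close> and \<open>u + w\<close> have a common direction, so that the infinitesimal parts
  are inner products with one and the same unit vector, and equality holds.\<close>

lemma dual_norm_triangle:
  fixes u v w z :: "'a::real_inner"
  shows "dual_norm (u + w) (v + z) \<le> dual_norm u v + dual_norm w z"
proof (cases "u = 0 \<or> w = 0")
  case True
  then show ?thesis
    using norm_triangle_ineq[of v z] inner_sgn_le_norm[of w v] inner_sgn_le_norm[of u z]
    by (auto simp: dual_norm_def plus_dual_def less_eq_dual_def less_dual_def dual_eq_iff
        inner_add_right)
next
  case nonzero: False
  show ?thesis
  proof (cases "norm (u + w) = norm u + norm w")
    case True
    then have "u + w \<noteq> 0"
      using nonzero by (auto simp: add_nonneg_eq_0_iff)
    then show ?thesis
      using nonzero sgn_add_of_norm_add_eq[OF _ _ True] True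
      by (simp add: dual_norm_def plus_dual_def inner_add_right)
  next
    case False
    then have "norm (u + w) < norm u + norm w"
      using norm_triangle_ineq[of u w] by simp
    moreover have "0 < norm u + norm w"
      using nonzero by (simp add: add_pos_pos)
    ultimately show ?thesis
      using nonzero by (simp add: dual_norm_def plus_dual_def less_eq_dual_def less_dual_def)
  qed
qed

section \<open>The magnitude of a dual quaternion\<close>

text \<open>Nested pairs serve as \<open>\<real>\<^sup>4\<close>, because the product type carries the Euclidean inner product.\<close>

definition quat_vec :: "quat \<Rightarrow> (real \<times> real) \<times> (real \<times> real)" where
  "quat_vec q = ((qre q, qim1 q), (qim2 q, qim3 q))"

lemma quat_vec_add: "quat_vec (p + q) = quat_vec p + quat_vec q"
  by (simp add: quat_vec_def plus_quat_def)

lemma quat_vec_eq_0_iff: "quat_vec q = 0 \<longleftrightarrow> q = 0"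
  by (auto simp: quat_vec_def zero_quat_def quat_eq_iff zero_prod_def)

lemma norm_quat_vec: "norm (quat_vec q) = qmod q"
  by (simp add: quat_vec_def qmod_def norm_prod_def add.assoc)

lemma inner_quat_vec:
  "quat_vec p \<bullet> quat_vec q = qre p * qre q + qim1 p * qim1 q + qim2 p * qim2 q + qim3 p * qim3 q"
  by (simp add: quat_vec_def)

lemma qre_cnj_eq_inner: "qre (p * qcnj q + q * qcnj p) = 2 * (quat_vec p \<bullet> quat_vec q)"
  by (simp add: inner_quat_vec plus_quat_def times_quat_def qcnj_def)

lemma dq_mag_Dual:
  "dq_mag (Dual r s) =
    (if r \<noteq> 0 then Dual (qmod r) (quat_vec r \<bullet> quat_vec s / qmod r) else Dual 0 (qmod s))"
  by (simp add: dq_mag_def qre_cnj_eq_inner)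

lemma dq_mag_eq_dual_norm: "dq_mag q = dual_norm (quat_vec (st q)) (quat_vec (infi q))"
  by (cases q)
    (simp add: dq_mag_Dual dual_norm_def quat_vec_eq_0_iff norm_quat_vec inner_sgn_eq)

lemma dq_mag_nonneg: "0 \<le> dq_mag q"
  by (simp add: dq_mag_eq_dual_norm dual_norm_nonneg)

lemma dq_mag_eq_0_iff: "dq_mag q = 0 \<longleftrightarrow> q = 0"
  by (cases q) (simp add: dq_mag_eq_dual_norm dual_norm_eq_0_iff quat_vec_eq_0_iff,
      simp add: zero_dual_def)

lemma dq_mag_triangle: "dq_mag (p + q) \<le> dq_mag p + dq_mag q"
proof -
  have "st (p + q) = st p + st q" "infi (p + q) = infi p + infi q"
    by (simp_all add: plus_dual_def)
  then show ?thesis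
    by (simp only: dq_mag_eq_dual_norm quat_vec_add dual_norm_triangle)
qed

lemma qmod_power2: "(qmod p)\<^sup>2 = (qre p)\<^sup>2 + (qim1 p)\<^sup>2 + (qim2 p)\<^sup>2 + (qim3 p)\<^sup>2"
  by (simp add: qmod_def)

lemma inner_quat_mult_left:
  "quat_vec (p * q) \<bullet> quat_vec (p * r) = (qmod p)\<^sup>2 * (quat_vec q \<bullet> quat_vec r)"
  unfolding inner_quat_vec qmod_power2 times_quat_def by (simp add: algebra_simps power2_eq_square)

lemma inner_quat_mult_right:
  "quat_vec (p * q) \<bullet> quat_vec (r * q) = (qmod q)\<^sup>2 * (quat_vec p \<bullet> quat_vec r)"
  unfolding inner_quat_vec qmod_power2 times_quat_def by (simp add: algebra_simps power2_eq_square)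

lemma qmod_nonneg: "0 \<le> qmod q"
  by (simp add: qmod_def)

lemma qmod_eq_0_iff: "qmod q = 0 \<longleftrightarrow> q = 0"
  by (metis norm_quat_vec norm_eq_zero quat_vec_eq_0_iff)

lemma qmod_mult: "qmod (p * q) = qmod p * qmod q"
proof -
  have "(qmod (p * q))\<^sup>2 = (qmod p * qmod q)\<^sup>2"
    using inner_quat_mult_left[of p q q]
    by (simp add: power2_norm_eq_inner norm_quat_vec[symmetric] power_mult_distrib)
  then show ?thesis
    by (simp add: qmod_nonneg)
qed

text \<open>When both standard parts are nonzero, the infinitesimal part obeys the product rule: the
  inner product of \<open>p q\<close> with \<open>p q' + p' q\<close> splits into one term for left multiplication by \<open>p\<close>
  and one for right multiplication by \<open>q\<close>.\<close>

lemma dq_mag_mult: "dq_mag (p * q) = dq_mag p * dq_mag q"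
proof -
  obtain a a' b b' where p: "p = Dual a a'" and q: "q = Dual b b'"
    by (cases p; cases q)
  have nz: "a * b \<noteq> 0 \<longleftrightarrow> a \<noteq> 0 \<and> b \<noteq> 0"
    by (metis mult_eq_0_iff qmod_eq_0_iff qmod_mult)
  have "quat_vec (a * b) \<bullet> quat_vec (a * b' + a' * b) / qmod (a * b)
      = qmod a * (quat_vec b \<bullet> quat_vec b' / qmod b) + quat_vec a \<bullet> quat_vec a' / qmod a * qmod b"
    if "a \<noteq> 0" "b \<noteq> 0"
    using that
    by (simp add: quat_vec_add inner_add_right inner_quat_mult_left inner_quat_mult_right qmod_mult
        qmod_eq_0_iff field_simps power2_eq_square)
  then show ?thesis
    using nz by (auto simp: p q dq_mag_Dual times_dual_def qmod_mult qmod_eq_0_iff[of 0])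
qed

section \<open>The two norms\<close>

lemma is_dq_norm_1: "is_dq_norm (dq_norm_1 :: dual_quaternion ^ 'n::finite \<Rightarrow> dual_number)"
  unfolding is_dq_norm_def
proof (intro conjI allI)
  fix x y :: "dual_quaternion ^ 'n" and q :: dual_quaternion
  show "0 \<le> dq_norm_1 x"
    by (simp add: dq_norm_1_def sum_nonneg dq_mag_nonneg)
  show "dq_norm_1 x = 0 \<longleftrightarrow> x = 0"
    by (simp add: dq_norm_1_def sum_nonneg_eq_0_iff dq_mag_nonneg dq_mag_eq_0_iff vec_eq_iff)
  show "dq_norm_1 (q *s x) = dq_mag q * dq_norm_1 x"
    by (simp add: dq_norm_1_def dq_mag_mult sum_distrib_left)
  show "dq_norm_1 (x + y) \<le> dq_norm_1 x + dq_norm_1 y"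
    by (simp add: dq_norm_1_def dq_mag_triangle sum_mono flip: sum.distrib)
qed

lemma dq_mag_le_norm_inf: "dq_mag (x $ i) \<le> dq_norm_inf x"
  for x :: "dual_quaternion ^ 'n::finite"
  by (simp add: dq_norm_inf_def)

lemma dq_norm_inf_le_iff: "dq_norm_inf x \<le> c \<longleftrightarrow> (\<forall>i. dq_mag (x $ i) \<le> c)"
  for x :: "dual_quaternion ^ 'n::finite"
  by (simp add: dq_norm_inf_def)

lemma is_dq_norm_inf: "is_dq_norm (dq_norm_inf :: dual_quaternion ^ 'n::finite \<Rightarrow> dual_number)"
  unfolding is_dq_norm_def
proof (intro conjI allI)
  fix x y :: "dual_quaternion ^ 'n" and q :: dual_quaternion
  show nonneg: "0 \<le> dq_norm_inf x"
    using dq_mag_nonneg dq_mag_le_norm_inf by (rule order_trans)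
  have "dq_norm_inf x = 0 \<longleftrightarrow> dq_norm_inf x \<le> 0"
    using nonneg by auto
  also have "\<dots> \<longleftrightarrow> (\<forall>i. dq_mag (x $ i) = 0)"
    by (metis dq_norm_inf_le_iff dq_mag_nonneg order_antisym order_refl)
  finally show "dq_norm_inf x = 0 \<longleftrightarrow> x = 0"
    by (simp add: dq_mag_eq_0_iff vec_eq_iff)
  have "mono (\<lambda>c. dq_mag q * c)"
    by (simp add: mono_def mult_left_mono dq_mag_nonneg)
  then have "dq_mag q * dq_norm_inf x = Max ((\<lambda>c. dq_mag q * c) ` range (\<lambda>i. dq_mag (x $ i)))"
    unfolding dq_norm_inf_def by (rule mono_Max_commute) auto
  then show "dq_norm_inf (q *s x) = dq_mag q * dq_norm_inf x"
    by (simp add: dq_norm_inf_def dq_mag_mult image_image)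
  have "dq_mag ((x + y) $ i) \<le> dq_norm_inf x + dq_norm_inf y" for i
  proof -
    have "dq_mag ((x + y) $ i) \<le> dq_mag (x $ i) + dq_mag (y $ i)"
      by (simp add: dq_mag_triangle)
    also have "\<dots> \<le> dq_norm_inf x + dq_norm_inf y"
      by (intro add_mono dq_mag_le_norm_inf)
    finally show ?thesis .
  qed
  then show "dq_norm_inf (x + y) \<le> dq_norm_inf x + dq_norm_inf y"
    by (simp add: dq_norm_inf_le_iff)
qed

theorem proposition6p2:
  shows "is_dq_norm (dq_norm_1 :: dual_quaternion ^ 'n::finite \<Rightarrow> dual_number) \<and>
         is_dq_norm (dq_norm_inf :: dual_quaternion ^ 'n::finite \<Rightarrow> dual_number)"
  by (simp add: is_dq_norm_1 is_dq_norm_inf)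

end
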